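(* Let $k$ be a field and $\Omega=\bigcup_{n\ge 1}\Omega_n$ a set of operation symbols, where the elements of $\Omega_n$ are $n$-ary. Every countably generated associative $\Omega$-algebra over $k$ can be embedded into a two-generated associative $\Omega$-algebra over $k$; that is, for every such countably generated $A$ there exist an associative $\Omega$-algebra $H$ generated as an $\Omega$-algebra by two elements and an injective homomorphism of associative $\Omega$-algebras $A\to H$.
   Context: An associative $\Omega$-algebra over a field $k$ is an associative $k$-algebra $A$ (not required to have a unit) together with, for each $n\ge 1$ and each $\delta\in\Omega_n$, a $k$-multilinear map $\delta:A^n\to A$ (no further identities are imposed). Homomorphisms are $k$-algebra homomorphisms (not required to preserve units) commuting with all operations in $\Omega$. An associative $\Omega$-algebra is generated by a subset $Y$ if the smallest $k$-subalgebra (not necessarily unital) containing $Y$ and closed under all operations in $\Omega$ is the whole algebra; it is countably generated if generated by an at most countable set. *)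

theory Defs
  imports "HOL-Algebra.Module" "HOL-Library.Countable_Set"
begin

text \<open>
  The inherited field \<open>one\<close> is irrelevant: no axiom below mentions it, so algebras need not be unital.
  The \<open>n\<close>-ary operation with symbol \<open>\<delta>\<close> is \<open>opn A n \<delta>\<close>; elements of \<open>A\<^sup>n\<close> are lists of length \<open>n\<close>.
\<close>

record ('k, 'o, 'a) omega_alg = "('k, 'a) module" +
  opn :: "nat \<Rightarrow> 'o \<Rightarrow> 'a list \<Rightarrow> 'a"

text \<open>
  A signature is a family \<open>\<Omega> n\<close> of sets of symbols, of which only the members with \<open>n \<ge> 1\<close> are used.
  The last two axioms say that an operation is \<open>K\<close>-linear in each argument, the other
  arguments being fixed.
\<close>

locale omega_algebra = K?: field K + A?: module K A
  for K (structure) and \<Omega> :: "nat \<Rightarrow> 'o set" and A :: "('k, 'o, 'a, 'm) omega_alg_scheme" (structure) +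
  assumes mult_closed:
      "\<lbrakk>x \<in> carrier A; y \<in> carrier A\<rbrakk> \<Longrightarrow> x \<otimes>\<^bsub>A\<^esub> y \<in> carrier A"
    and mult_assoc:
      "\<lbrakk>x \<in> carrier A; y \<in> carrier A; z \<in> carrier A\<rbrakk> \<Longrightarrow>
        (x \<otimes>\<^bsub>A\<^esub> y) \<otimes>\<^bsub>A\<^esub> z = x \<otimes>\<^bsub>A\<^esub> (y \<otimes>\<^bsub>A\<^esub> z)"
    and mult_add_left:
      "\<lbrakk>x \<in> carrier A; y \<in> carrier A; z \<in> carrier A\<rbrakk> \<Longrightarrow>
        (x \<oplus>\<^bsub>A\<^esub> y) \<otimes>\<^bsub>A\<^esub> z = (x \<otimes>\<^bsub>A\<^esub> z) \<oplus>\<^bsub>A\<^esub> (y \<otimes>\<^bsub>A\<^esub> z)"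
    and mult_add_right:
      "\<lbrakk>x \<in> carrier A; y \<in> carrier A; z \<in> carrier A\<rbrakk> \<Longrightarrow>
        z \<otimes>\<^bsub>A\<^esub> (x \<oplus>\<^bsub>A\<^esub> y) = (z \<otimes>\<^bsub>A\<^esub> x) \<oplus>\<^bsub>A\<^esub> (z \<otimes>\<^bsub>A\<^esub> y)"
    and mult_smult_left:
      "\<lbrakk>c \<in> carrier K; x \<in> carrier A; y \<in> carrier A\<rbrakk> \<Longrightarrow>
        (c \<odot>\<^bsub>A\<^esub> x) \<otimes>\<^bsub>A\<^esub> y = c \<odot>\<^bsub>A\<^esub> (x \<otimes>\<^bsub>A\<^esub> y)"
    and mult_smult_right:
      "\<lbrakk>c \<in> carrier K; x \<in> carrier A; y \<in> carrier A\<rbrakk> \<Longrightarrow>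
        x \<otimes>\<^bsub>A\<^esub> (c \<odot>\<^bsub>A\<^esub> y) = c \<odot>\<^bsub>A\<^esub> (x \<otimes>\<^bsub>A\<^esub> y)"
    and opn_closed:
      "\<lbrakk>n \<ge> 1; \<delta> \<in> \<Omega> n; length xs = n; set xs \<subseteq> carrier A\<rbrakk> \<Longrightarrow> opn A n \<delta> xs \<in> carrier A"
    and opn_add:
      "\<lbrakk>n \<ge> 1; \<delta> \<in> \<Omega> n; length xs = n; set xs \<subseteq> carrier A; i < n; x \<in> carrier A; y \<in> carrier A\<rbrakk> \<Longrightarrow>
        opn A n \<delta> (xs[i := x \<oplus>\<^bsub>A\<^esub> y]) = opn A n \<delta> (xs[i := x]) \<oplus>\<^bsub>A\<^esub> opn A n \<delta> (xs[i := y])"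
    and opn_smult:
      "\<lbrakk>n \<ge> 1; \<delta> \<in> \<Omega> n; length xs = n; set xs \<subseteq> carrier A; i < n; c \<in> carrier K; x \<in> carrier A\<rbrakk> \<Longrightarrow>
        opn A n \<delta> (xs[i := c \<odot>\<^bsub>A\<^esub> x]) = c \<odot>\<^bsub>A\<^esub> opn A n \<delta> (xs[i := x])"

definition omega_subalgebra ::
    "('k, 'l) ring_scheme \<Rightarrow> (nat \<Rightarrow> 'o set) \<Rightarrow> ('k, 'o, 'a, 'm) omega_alg_scheme \<Rightarrow> 'a set \<Rightarrow> bool" where
  "omega_subalgebra K \<Omega> A B \<longleftrightarrow>
     submodule B K A \<and>
     (\<forall>x\<in>B. \<forall>y\<in>B. x \<otimes>\<^bsub>A\<^esub> y \<in> B) \<and>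
     (\<forall>n\<ge>1. \<forall>\<delta>\<in>\<Omega> n. \<forall>xs. length xs = n \<longrightarrow> set xs \<subseteq> B \<longrightarrow> opn A n \<delta> xs \<in> B)"

definition omega_span ::
    "('k, 'l) ring_scheme \<Rightarrow> (nat \<Rightarrow> 'o set) \<Rightarrow> ('k, 'o, 'a, 'm) omega_alg_scheme \<Rightarrow> 'a set \<Rightarrow> 'a set" where
  "omega_span K \<Omega> A Y = \<Inter> {B. omega_subalgebra K \<Omega> A B \<and> Y \<subseteq> B}"

definition omega_generated_by ::
    "('k, 'l) ring_scheme \<Rightarrow> (nat \<Rightarrow> 'o set) \<Rightarrow> ('k, 'o, 'a, 'm) omega_alg_scheme \<Rightarrow> 'a set \<Rightarrow> bool" where
  "omega_generated_by K \<Omega> A Y \<longleftrightarrow> Y \<subseteq> carrier A \<and> omega_span K \<Omega> A Y = carrier A"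

definition countably_generated ::
    "('k, 'l) ring_scheme \<Rightarrow> (nat \<Rightarrow> 'o set) \<Rightarrow> ('k, 'o, 'a, 'm) omega_alg_scheme \<Rightarrow> bool" where
  "countably_generated K \<Omega> A \<longleftrightarrow> (\<exists>Y. countable Y \<and> omega_generated_by K \<Omega> A Y)"

definition two_generated ::
    "('k, 'l) ring_scheme \<Rightarrow> (nat \<Rightarrow> 'o set) \<Rightarrow> ('k, 'o, 'a, 'm) omega_alg_scheme \<Rightarrow> bool" where
  "two_generated K \<Omega> A \<longleftrightarrow> (\<exists>x y. x \<noteq> y \<and> omega_generated_by K \<Omega> A {x, y})"

text \<open>\<open>hom\<close> of the multiplicative structure does not require preservation of \<open>one\<close>.\<close>

definition omega_hom ::
    "('k, 'l) ring_scheme \<Rightarrow> (nat \<Rightarrow> 'o set) \<Rightarrow> ('k, 'o, 'a, 'm) omega_alg_scheme \<Rightarrow>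
     ('k, 'o, 'b, 'n) omega_alg_scheme \<Rightarrow> ('a \<Rightarrow> 'b) set" where
  "omega_hom K \<Omega> A B =
     {h. h \<in> hom (add_monoid A) (add_monoid B) \<and>
         h \<in> hom A B \<and>
         (\<forall>c\<in>carrier K. \<forall>x\<in>carrier A. h (c \<odot>\<^bsub>A\<^esub> x) = c \<odot>\<^bsub>B\<^esub> h x) \<and>
         (\<forall>n\<ge>1. \<forall>\<delta>\<in>\<Omega> n. \<forall>xs. length xs = n \<longrightarrow> set xs \<subseteq> carrier A \<longrightarrow>
            h (opn A n \<delta> xs) = opn B n \<delta> (map h xs))}"

text \<open>
  HOL cannot quantify existentially over types, so an existence claim for a two-generated algebra
  must name a type for its elements. We use sets of formal expressions in two generators: mapping
  an element of an algebra generated by \<open>x\<close> and \<open>y\<close> to the set of expressions with that value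
  is injective, so every two-generated algebra, on any type, has an isomorphic copy whose carrier
  lies in this type. The choice therefore imposes no restriction.
\<close>

datatype ('k, 'o) omega_expr =
    Gen bool
  | Plus "('k, 'o) omega_expr" "('k, 'o) omega_expr"
  | Scale 'k "('k, 'o) omega_expr"
  | Times "('k, 'o) omega_expr" "('k, 'o) omega_expr"
  | Apply 'o "('k, 'o) omega_expr list"

end

theory Submission
  imports Defs
begin

text \<open>
  Let \<open>a\<^sub>0, a\<^sub>1, \<dots>\<close> generate \<open>A\<close> and let \<open>V\<close> be the space of sequences in the unitization of \<open>A\<close>.
  In the algebra of linear operators on \<open>V\<close> let \<open>x\<close> be the shift \<open>v \<mapsto> (v\<^sub>j\<^sub>+\<^sub>1)\<^sub>j\<close>, and let \<open>y\<close> send \<open>v\<close> to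
  \<open>(c\<^sub>j v\<^sub>0)\<^sub>j\<close>, where \<open>c\<^sub>0 = 1\<close> and \<open>c\<^sub>i\<^sub>+\<^sub>1 = a\<^sub>i\<close>. Because \<open>c\<^sub>0 = 1\<close>, sending \<open>b\<close> to the operator
  \<open>v \<mapsto> (c\<^sub>j b v\<^sub>0)\<^sub>j\<close> is a homomorphism \<open>h\<close>, and \<open>h a\<^sub>i = y x\<^sup>i\<^sup>+\<^sup>1 y\<close>. A linear left inverse \<open>p\<close> of \<open>h\<close> extends
  the operations of \<open>A\<close> to all operators by \<open>\<delta>(T\<^sub>1, \<dots>, T\<^sub>n) = h (\<delta> (p T\<^sub>1, \<dots>, p T\<^sub>n))\<close>, so the
  subalgebra generated by \<open>x\<close> and \<open>y\<close> contains \<open>h A\<close>.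
\<close>

section \<open>Rules for subalgebras, generation and homomorphisms\<close>

lemma (in omega_algebra) omega_subalgebraI:
  assumes "B \<subseteq> carrier A" "\<zero>\<^bsub>A\<^esub> \<in> B"
    and "\<And>x y. \<lbrakk>x \<in> B; y \<in> B\<rbrakk> \<Longrightarrow> x \<oplus>\<^bsub>A\<^esub> y \<in> B"
    and smult: "\<And>c x. \<lbrakk>c \<in> carrier K; x \<in> B\<rbrakk> \<Longrightarrow> c \<odot>\<^bsub>A\<^esub> x \<in> B"
    and "\<And>x y. \<lbrakk>x \<in> B; y \<in> B\<rbrakk> \<Longrightarrow> x \<otimes>\<^bsub>A\<^esub> y \<in> B"
    and "\<And>n \<delta> xs. \<lbrakk>n \<ge> 1; \<delta> \<in> \<Omega> n; length xs = n; set xs \<subseteq> B\<rbrakk> \<Longrightarrow> opn A n \<delta> xs \<in> B"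
  shows "omega_subalgebra K \<Omega> A B"
proof -
  \<comment> \<open>\<open>submodule\<close> also asks for closure under negation, which scaling by
    \<open>\<ominus> \<one>\<close> supplies.\<close>
  have "\<ominus>\<^bsub>A\<^esub> x \<in> B" if "x \<in> B" for x
  proof -
    have "\<ominus>\<^bsub>A\<^esub> x = (\<ominus> \<one>) \<odot>\<^bsub>A\<^esub> x"
      using that assms(1) by (subst smult_l_minus) auto
    then show ?thesis using smult[of "\<ominus> \<one>" x] that by simp
  qed
  then have "submodule B K A"
    using assms by (intro submoduleI) auto
  then show ?thesis
    using assms(5,6) unfolding omega_subalgebra_def by simp
qed

lemma (in omega_algebra) omega_subalgebraD:
  assumes "omega_subalgebra K \<Omega> A B"
  shows "B \<subseteq> carrier A" "\<zero>\<^bsub>A\<^esub> \<in> B"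
    and "\<And>x y. \<lbrakk>x \<in> B; y \<in> B\<rbrakk> \<Longrightarrow> x \<oplus>\<^bsub>A\<^esub> y \<in> B"
    and "\<And>c x. \<lbrakk>c \<in> carrier K; x \<in> B\<rbrakk> \<Longrightarrow> c \<odot>\<^bsub>A\<^esub> x \<in> B"
    and "\<And>x y. \<lbrakk>x \<in> B; y \<in> B\<rbrakk> \<Longrightarrow> x \<otimes>\<^bsub>A\<^esub> y \<in> B"
    and "\<And>n \<delta> xs. \<lbrakk>n \<ge> 1; \<delta> \<in> \<Omega> n; length xs = n; set xs \<subseteq> B\<rbrakk> \<Longrightarrow> opn A n \<delta> xs \<in> B"
proof -
  have s: "submodule B K A"
    using assms unfolding omega_subalgebra_def by blast
  show "\<zero>\<^bsub>A\<^esub> \<in> B"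
    using subgroup.one_closed[OF submodule.axioms(1)[OF s]] by simp
qed (use assms submoduleE(1,4,5)[of B] in \<open>simp_all add: omega_subalgebra_def\<close>)

lemma (in omega_algebra) omega_subalgebra_carrier: "omega_subalgebra K \<Omega> A (carrier A)"
  by (rule omega_subalgebraI) (auto intro: mult_closed opn_closed)

text \<open>The span cannot exceed the carrier because \<open>carrier A\<close> is itself one of the
  subalgebras intersected in \<open>omega_span\<close>.\<close>

lemma (in omega_algebra) omega_generated_byI:
  assumes "Y \<subseteq> carrier A"
    and "\<And>B. \<lbrakk>omega_subalgebra K \<Omega> A B; Y \<subseteq> B\<rbrakk> \<Longrightarrow> carrier A \<subseteq> B"
  shows "omega_generated_by K \<Omega> A Y"
proof -
  have "omega_span K \<Omega> A Y = carrier A"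
    using assms omega_subalgebra_carrier unfolding omega_span_def by blast
  then show ?thesis
    using assms(1) unfolding omega_generated_by_def by blast
qed

lemma omega_homD:
  assumes "h \<in> omega_hom K \<Omega> A B"
  shows "\<And>x. x \<in> carrier A \<Longrightarrow> h x \<in> carrier B"
    and "\<And>x y. \<lbrakk>x \<in> carrier A; y \<in> carrier A\<rbrakk> \<Longrightarrow> h (x \<oplus>\<^bsub>A\<^esub> y) = h x \<oplus>\<^bsub>B\<^esub> h y"
    and "\<And>x y. \<lbrakk>x \<in> carrier A; y \<in> carrier A\<rbrakk> \<Longrightarrow> h (x \<otimes>\<^bsub>A\<^esub> y) = h x \<otimes>\<^bsub>B\<^esub> h y"
    and "\<And>c x. \<lbrakk>c \<in> carrier K; x \<in> carrier A\<rbrakk> \<Longrightarrow> h (c \<odot>\<^bsub>A\<^esub> x) = c \<odot>\<^bsub>B\<^esub> h x"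
    and "\<And>n \<delta> xs. \<lbrakk>n \<ge> 1; \<delta> \<in> \<Omega> n; length xs = n; set xs \<subseteq> carrier A\<rbrakk> \<Longrightarrow>
      h (opn A n \<delta> xs) = opn B n \<delta> (map h xs)"
proof -
  have "h \<in> hom (add_monoid A) (add_monoid B)" and mult: "h \<in> hom A B"
    using assms unfolding omega_hom_def by blast+
  then show "\<And>x y. \<lbrakk>x \<in> carrier A; y \<in> carrier A\<rbrakk> \<Longrightarrow> h (x \<oplus>\<^bsub>A\<^esub> y) = h x \<oplus>\<^bsub>B\<^esub> h y"
    using hom_mult[of h "add_monoid A" "add_monoid B"] by simp
  show "\<And>x. x \<in> carrier A \<Longrightarrow> h x \<in> carrier B"
    and "\<And>x y. \<lbrakk>x \<in> carrier A; y \<in> carrier A\<rbrakk> \<Longrightarrow> h (x \<otimes>\<^bsub>A\<^esub> y) = h x \<otimes>\<^bsub>B\<^esub> h y"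
    using hom_in_carrier[OF mult] hom_mult[OF mult] by auto
qed (use assms in \<open>unfold omega_hom_def, blast+\<close>)

lemma omega_homI:
  assumes "\<And>x. x \<in> carrier A \<Longrightarrow> h x \<in> carrier B"
    and "\<And>x y. \<lbrakk>x \<in> carrier A; y \<in> carrier A\<rbrakk> \<Longrightarrow> h (x \<oplus>\<^bsub>A\<^esub> y) = h x \<oplus>\<^bsub>B\<^esub> h y"
    and "\<And>x y. \<lbrakk>x \<in> carrier A; y \<in> carrier A\<rbrakk> \<Longrightarrow> h (x \<otimes>\<^bsub>A\<^esub> y) = h x \<otimes>\<^bsub>B\<^esub> h y"
    and "\<And>c x. \<lbrakk>c \<in> carrier K; x \<in> carrier A\<rbrakk> \<Longrightarrow> h (c \<odot>\<^bsub>A\<^esub> x) = c \<odot>\<^bsub>B\<^esub> h x"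
    and "\<And>n \<delta> xs. \<lbrakk>n \<ge> 1; \<delta> \<in> \<Omega> n; length xs = n; set xs \<subseteq> carrier A\<rbrakk> \<Longrightarrow>
      h (opn A n \<delta> xs) = opn B n \<delta> (map h xs)"
  shows "h \<in> omega_hom K \<Omega> A B"
  using assms unfolding omega_hom_def hom_def by simp

section \<open>Transport of structure along an injective map\<close>

definition image_algebra ::
    "('k, 'o, 'a, 'm) omega_alg_scheme \<Rightarrow> 'a set \<Rightarrow> ('a \<Rightarrow> 'b) \<Rightarrow> ('k, 'o, 'b) omega_alg" where
  "image_algebra B S \<phi> = (let \<psi> = inv_into S \<phi> in
     \<lparr>carrier = \<phi> ` S,
      mult = (\<lambda>u v. \<phi> (\<psi> u \<otimes>\<^bsub>B\<^esub> \<psi> v)),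
      one = \<phi> \<one>\<^bsub>B\<^esub>,
      zero = \<phi> \<zero>\<^bsub>B\<^esub>,
      add = (\<lambda>u v. \<phi> (\<psi> u \<oplus>\<^bsub>B\<^esub> \<psi> v)),
      smult = (\<lambda>c u. \<phi> (c \<odot>\<^bsub>B\<^esub> \<psi> u)),
      opn = (\<lambda>n \<delta> us. \<phi> (opn B n \<delta> (map \<psi> us)))\<rparr>)"

lemma list_in_image:
  assumes "set us \<subseteq> \<phi> ` S"
  obtains xs where "set xs \<subseteq> S" "us = map \<phi> xs"
proof
  show "set (map (inv_into S \<phi>) us) \<subseteq> S"
    using assms by (auto intro: inv_into_into)
  show "us = map \<phi> (map (inv_into S \<phi>) us)"
    using assms by (auto simp: f_inv_into_f subset_iff intro!: map_idI[symmetric])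
qed

context omega_algebra
begin

text \<open>Injectivity makes \<open>inv_into S \<phi>\<close> undo \<open>\<phi>\<close> on
  \<open>S\<close>, so every operation can be computed on representatives. Later arguments rely on
  these equations instead of unfolding the definition.\<close>

lemma image_algebra_simps:
  assumes "inj_on \<phi> S"
  shows "carrier (image_algebra A S \<phi>) = \<phi> ` S"
    and "\<zero>\<^bsub>image_algebra A S \<phi>\<^esub> = \<phi> \<zero>\<^bsub>A\<^esub>"
    and "\<And>x y. \<lbrakk>x \<in> S; y \<in> S\<rbrakk> \<Longrightarrow> \<phi> x \<otimes>\<^bsub>image_algebra A S \<phi>\<^esub> \<phi> y = \<phi> (x \<otimes>\<^bsub>A\<^esub> y)"
    and "\<And>x y. \<lbrakk>x \<in> S; y \<in> S\<rbrakk> \<Longrightarrow> \<phi> x \<oplus>\<^bsub>image_algebra A S \<phi>\<^esub> \<phi> y = \<phi> (x \<oplus>\<^bsub>A\<^esub> y)"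
    and "\<And>c x. x \<in> S \<Longrightarrow> c \<odot>\<^bsub>image_algebra A S \<phi>\<^esub> \<phi> x = \<phi> (c \<odot>\<^bsub>A\<^esub> x)"
    and "\<And>n \<delta> xs. set xs \<subseteq> S \<Longrightarrow> opn (image_algebra A S \<phi>) n \<delta> (map \<phi> xs) = \<phi> (opn A n \<delta> xs)"
proof -
  fix n \<delta> xs
  assume "set xs \<subseteq> S"
  then have "map (inv_into S \<phi> \<circ> \<phi>) xs = xs"
    using assms by (intro map_idI) auto
  then show "opn (image_algebra A S \<phi>) n \<delta> (map \<phi> xs) = \<phi> (opn A n \<delta> xs)"
    by (simp add: image_algebra_def Let_def)
qed (use assms in \<open>auto simp: image_algebra_def Let_def\<close>)

text \<open>Each axiom is inherited from \<open>A\<close> through representatives; closure of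
  \<open>S\<close> ensures that the result of an operation on representatives is again a
  representative.\<close>

lemma omega_algebra_image_algebra:
  assumes S: "omega_subalgebra K \<Omega> A S" and inj: "inj_on \<phi> S"
  shows "omega_algebra K \<Omega> (image_algebra A S \<phi>)"
proof -
  note sub = omega_subalgebraD[OF S]
  note simps = image_algebra_simps[OF inj]
  have S_carrier: "x \<in> carrier A" if "x \<in> S" for x
    using sub(1) that by blast
  have ab: "abelian_group (image_algebra A S \<phi>)"
  proof (rule abelian_groupI)
    fix u assume "u \<in> carrier (image_algebra A S \<phi>)"
    then obtain x where x: "x \<in> S" "u = \<phi> x" by (auto simp: simps)
    have n: "(\<ominus> \<one>) \<odot>\<^bsub>A\<^esub> x \<in> S" using x sub(4) by simp
    have "(\<ominus> \<one>) \<odot>\<^bsub>A\<^esub> x \<oplus>\<^bsub>A\<^esub> x = \<zero>\<^bsub>A\<^esub>"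
      using S_carrier[OF x(1)] by (simp add: smult_l_minus A.M.l_neg)
    then show "\<exists>v\<in>carrier (image_algebra A S \<phi>). v \<oplus>\<^bsub>image_algebra A S \<phi>\<^esub> u = \<zero>\<^bsub>image_algebra A S \<phi>\<^esub>"
      using n x by (intro bexI[of _ "\<phi> ((\<ominus> \<one>) \<odot>\<^bsub>A\<^esub> x)"]) (auto simp: simps)
  qed (auto simp: simps sub S_carrier A.M.a_assoc intro!: arg_cong[of _ _ \<phi>] A.M.a_comm)
  have mod: "module K (image_algebra A S \<phi>)"
    by (rule moduleI[OF K.is_cring ab])
      (auto simp: simps sub S_carrier smult_l_distr smult_r_distr smult_assoc1)
  \<comment> \<open>Multilinearity is phrased with list updates, so an update of the image list is
    first moved to the list of representatives.\<close>
  have opn: "opn (image_algebra A S \<phi>) n \<delta> ((map \<phi> xs)[i := \<phi> x]) = \<phi> (opn A n \<delta> (xs[i := x]))"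
    if "set xs \<subseteq> S" "x \<in> S" for n \<delta> xs i x
    using that set_update_subset_insert[of xs i x] simps(6)[of "xs[i := x]" n \<delta>]
    by (auto simp: map_update)
  have opn_in: "opn A n \<delta> (xs[i := x]) \<in> S"
    if "n \<ge> 1" "\<delta> \<in> \<Omega> n" "length xs = n" "set xs \<subseteq> S" "x \<in> S" for n \<delta> xs i x
    using that set_update_subset_insert[of xs i x] by (intro sub) auto
  show ?thesis
  proof (intro omega_algebra.intro omega_algebra_axioms.intro)
    fix n \<delta> us
    assume n: "1 \<le> n" "\<delta> \<in> \<Omega> n" "length us = n" "set us \<subseteq> carrier (image_algebra A S \<phi>)"
    then obtain xs where xs: "set xs \<subseteq> S" "us = map \<phi> xs" "length xs = n"
      using list_in_image[of us \<phi> S] by (metis length_map simps(1))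
    show "opn (image_algebra A S \<phi>) n \<delta> us \<in> carrier (image_algebra A S \<phi>)"
      using n xs by (auto simp: simps sub)
    fix i u
    assume i: "i < n" and u: "u \<in> carrier (image_algebra A S \<phi>)"
    from u obtain x where x: "x \<in> S" "u = \<phi> x" by (auto simp: simps)
    show "opn (image_algebra A S \<phi>) n \<delta> (us[i := u \<oplus>\<^bsub>image_algebra A S \<phi>\<^esub> v]) =
        opn (image_algebra A S \<phi>) n \<delta> (us[i := u]) \<oplus>\<^bsub>image_algebra A S \<phi>\<^esub> opn (image_algebra A S \<phi>) n \<delta> (us[i := v])"
      if v: "v \<in> carrier (image_algebra A S \<phi>)" for v
    proof -
      from v obtain y where y: "y \<in> S" "v = \<phi> y" by (auto simp: simps)
      show ?thesis
        using n i xs x y sub(1) by (simp add: simps opn sub opn_in opn_add S_carrier subset_trans)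
    qed
    show "opn (image_algebra A S \<phi>) n \<delta> (us[i := c \<odot>\<^bsub>image_algebra A S \<phi>\<^esub> u]) =
        c \<odot>\<^bsub>image_algebra A S \<phi>\<^esub> opn (image_algebra A S \<phi>) n \<delta> (us[i := u])"
      if "c \<in> carrier K" for c
      using that n i xs x sub(1) by (simp add: simps opn sub opn_in opn_smult S_carrier subset_trans)
  qed (use mod K.field_axioms in \<open>auto simp: simps sub S_carrier mult_assoc mult_add_left mult_add_right
        mult_smult_left mult_smult_right\<close>)
qed

end

section \<open>Expressions in two generators and their values\<close>

fun expr_value ::
    "('k, 'o, 'a, 'm) omega_alg_scheme \<Rightarrow> 'a \<Rightarrow> 'a \<Rightarrow> ('k, 'o) omega_expr \<Rightarrow> 'a" where
  "expr_value A x y (Gen b) = (if b then x else y)"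
| "expr_value A x y (Plus e f) = expr_value A x y e \<oplus>\<^bsub>A\<^esub> expr_value A x y f"
| "expr_value A x y (Scale c e) = c \<odot>\<^bsub>A\<^esub> expr_value A x y e"
| "expr_value A x y (Times e f) = expr_value A x y e \<otimes>\<^bsub>A\<^esub> expr_value A x y f"
| "expr_value A x y (Apply \<delta> es) = opn A (length es) \<delta> (map (expr_value A x y) es)"

text \<open>The datatype allows any scalar of type \<open>'k\<close>, any symbol and any argument
  list. Since \<open>Apply\<close> carries no arity, the list length takes that role, and
  \<open>es \<noteq> []\<close> expresses that arities are at least 1.\<close>

fun wf_expr :: "('k, 'l) ring_scheme \<Rightarrow> (nat \<Rightarrow> 'o set) \<Rightarrow> ('k, 'o) omega_expr \<Rightarrow> bool" where
  "wf_expr K \<Omega> (Gen b) \<longleftrightarrow> True"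
| "wf_expr K \<Omega> (Plus e f) \<longleftrightarrow> wf_expr K \<Omega> e \<and> wf_expr K \<Omega> f"
| "wf_expr K \<Omega> (Scale c e) \<longleftrightarrow> c \<in> carrier K \<and> wf_expr K \<Omega> e"
| "wf_expr K \<Omega> (Times e f) \<longleftrightarrow> wf_expr K \<Omega> e \<and> wf_expr K \<Omega> f"
| "wf_expr K \<Omega> (Apply \<delta> es) \<longleftrightarrow> es \<noteq> [] \<and> \<delta> \<in> \<Omega> (length es) \<and> (\<forall>e\<in>set es. wf_expr K \<Omega> e)"

context omega_algebra
begin

text \<open>With \<open>carrier A\<close> for \<open>B\<close> this keeps all values inside the
  algebra; with a smaller \<open>B\<close> it shows that a subalgebra through \<open>x\<close> and
  \<open>y\<close> contains every value.\<close>

lemma expr_value_in_subalgebra: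
  assumes "omega_subalgebra K \<Omega> A B" "x \<in> B" "y \<in> B" "wf_expr K \<Omega> e"
  shows "expr_value A x y e \<in> B"
  using assms(4)
proof (induction e)
  case (Apply \<delta> es)
  then show ?case
    using omega_subalgebraD(6)[OF assms(1), of "length es" \<delta> "map (expr_value A x y) es"]
    by (auto simp: Suc_le_eq)
qed (use assms omega_subalgebraD[OF assms(1)] in auto)

text \<open>Each closure condition is witnessed by the matching constructor. Together with the
  preceding lemma, the values form exactly the subalgebra generated by \<open>x\<close> and
  \<open>y\<close>.\<close>

lemma expr_values_subalgebra:
  assumes "x \<in> carrier A" "y \<in> carrier A"
  shows "omega_subalgebra K \<Omega> A (expr_value A x y ` Collect (wf_expr K \<Omega>))"
    (is "omega_subalgebra K \<Omega> A ?S")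
proof (rule omega_subalgebraI)
  show "?S \<subseteq> carrier A"
    using expr_value_in_subalgebra[OF omega_subalgebra_carrier assms] by auto
  show "\<zero>\<^bsub>A\<^esub> \<in> ?S"
    \<comment> \<open>No constructor denotes zero, so zero is obtained as a multiple of a
      generator.\<close>
    using assms by (intro image_eqI[of _ _ "Scale \<zero> (Gen True)"]) auto
  show "u \<oplus>\<^bsub>A\<^esub> v \<in> ?S" "u \<otimes>\<^bsub>A\<^esub> v \<in> ?S" if uv: "u \<in> ?S" "v \<in> ?S" for u v
  proof -
    obtain e f where ef: "u = expr_value A x y e" "v = expr_value A x y f" "wf_expr K \<Omega> e" "wf_expr K \<Omega> f"
      using uv by auto
    show "u \<oplus>\<^bsub>A\<^esub> v \<in> ?S" using ef by (intro image_eqI[of _ _ "Plus e f"]) auto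
    show "u \<otimes>\<^bsub>A\<^esub> v \<in> ?S" using ef by (intro image_eqI[of _ _ "Times e f"]) auto
  qed
  show "c \<odot>\<^bsub>A\<^esub> u \<in> ?S" if "c \<in> carrier K" and u: "u \<in> ?S" for c u
  proof -
    obtain e where "u = expr_value A x y e" "wf_expr K \<Omega> e" using u by auto
    then show ?thesis using that by (intro image_eqI[of _ _ "Scale c e"]) auto
  qed
  show "opn A n \<delta> us \<in> ?S" if n: "n \<ge> 1" "\<delta> \<in> \<Omega> n" "length us = n" "set us \<subseteq> ?S" for n \<delta> us
  proof -
    obtain es where "set es \<subseteq> Collect (wf_expr K \<Omega>)" "us = map (expr_value A x y) es"
      using list_in_image[OF n(4)] .
    then show ?thesis using n by (intro image_eqI[of _ _ "Apply \<delta> es"]) auto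
  qed
qed

text \<open>This moves the subalgebra \<open>S\<close> generated by \<open>x\<close> and
  \<open>y\<close> to the type fixed in the theorem: an element is renamed to the set of well-formed
  expressions with that value. Distinctness of \<open>x\<close> and \<open>y\<close> passes to their
  images, as \<open>two_generated\<close> demands.\<close>

lemma two_generated_expr_copy:
  assumes xy: "x \<in> carrier A" "y \<in> carrier A" "x \<noteq> y"
  obtains S and H :: "('k, 'o, ('k, 'o) omega_expr set) omega_alg" and \<phi>
  where "omega_subalgebra K \<Omega> A S" "x \<in> S" "y \<in> S" "omega_algebra K \<Omega> H" "two_generated K \<Omega> H"
    "\<phi> \<in> omega_hom K \<Omega> (A\<lparr>carrier := S\<rparr>) H" "inj_on \<phi> S"
proof -
  define S where "S = expr_value A x y ` Collect (wf_expr K \<Omega>)"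
  define \<phi> where "\<phi> b = {e. wf_expr K \<Omega> e \<and> expr_value A x y e = b}" for b
  define H where "H = image_algebra A S \<phi>"
  have sub: "omega_subalgebra K \<Omega> A S"
    unfolding S_def using xy by (intro expr_values_subalgebra)
  note subD = omega_subalgebraD[OF sub]
  \<comment> \<open>For \<open>b\<close> in \<open>S\<close> the set \<open>\<phi> b\<close> is
    nonempty, and the value of any expression in it is \<open>b\<close>.\<close>
  have inj: "inj_on \<phi> S"
    unfolding inj_on_def S_def \<phi>_def by auto
  note simps = image_algebra_simps[OF inj, folded H_def]
  have xS: "x \<in> S" unfolding S_def by (intro image_eqI[of _ _ "Gen True"]) auto
  have yS: "y \<in> S" unfolding S_def by (intro image_eqI[of _ _ "Gen False"]) auto
  have alg: "omega_algebra K \<Omega> H"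
    unfolding H_def by (rule omega_algebra_image_algebra[OF sub inj])
  have "omega_generated_by K \<Omega> H {\<phi> x, \<phi> y}"
  proof (rule omega_algebra.omega_generated_byI[OF alg])
    fix B assume B: "omega_subalgebra K \<Omega> H B" "{\<phi> x, \<phi> y} \<subseteq> B"
    note BD = omega_algebra.omega_subalgebraD[OF alg B(1)]
    \<comment> \<open>The preimage of \<open>B\<close> under \<open>\<phi>\<close> is a subalgebra
      of \<open>A\<close> through \<open>x\<close> and \<open>y\<close>, hence it contains every
      expression value, that is, all of \<open>S\<close>.\<close>
    have "omega_subalgebra K \<Omega> A {s \<in> S. \<phi> s \<in> B}"
    proof (rule omega_subalgebraI)
      show "\<zero>\<^bsub>A\<^esub> \<in> {s \<in> S. \<phi> s \<in> B}"
        using BD(2) subD(2) by (simp add: simps)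
      show "u \<oplus>\<^bsub>A\<^esub> v \<in> {s \<in> S. \<phi> s \<in> B}" if "u \<in> {s \<in> S. \<phi> s \<in> B}" "v \<in> {s \<in> S. \<phi> s \<in> B}" for u v
        using that BD(3)[of "\<phi> u" "\<phi> v"] by (simp add: simps subD)
      show "u \<otimes>\<^bsub>A\<^esub> v \<in> {s \<in> S. \<phi> s \<in> B}" if "u \<in> {s \<in> S. \<phi> s \<in> B}" "v \<in> {s \<in> S. \<phi> s \<in> B}" for u v
        using that BD(5)[of "\<phi> u" "\<phi> v"] by (simp add: simps subD)
      show "c \<odot>\<^bsub>A\<^esub> u \<in> {s \<in> S. \<phi> s \<in> B}" if "c \<in> carrier K" "u \<in> {s \<in> S. \<phi> s \<in> B}" for c u
        using that BD(4)[of c "\<phi> u"] by (simp add: simps subD)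
      show "opn A n \<delta> us \<in> {s \<in> S. \<phi> s \<in> B}"
        if "n \<ge> 1" "\<delta> \<in> \<Omega> n" "length us = n" "set us \<subseteq> {s \<in> S. \<phi> s \<in> B}" for n \<delta> us
      proof -
        have "set us \<subseteq> S" "set (map \<phi> us) \<subseteq> B" using that by auto
        then show ?thesis
          using that BD(6)[of n \<delta> "map \<phi> us"] subD(6)[of n \<delta> us] by (simp add: simps)
      qed
    qed (use subD(1) in auto)
    then show "carrier H \<subseteq> B"
      using expr_value_in_subalgebra[of _ x y] B(2) xS yS by (force simp: simps(1) S_def)
  qed (use xS yS in \<open>auto simp: simps\<close>)
  moreover have "\<phi> x \<noteq> \<phi> y"
    using inj xS yS xy(3) by (auto dest: inj_onD)
  ultimately have two: "two_generated K \<Omega> H"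
    unfolding two_generated_def by blast
  have "\<phi> \<in> omega_hom K \<Omega> (A\<lparr>carrier := S\<rparr>) H"
    unfolding omega_hom_def hom_def by (auto simp: simps)
  then show thesis
    using that sub xS yS alg two inj by blast
qed

end

section \<open>The algebra of linear operators on a module\<close>

definition linear_maps ::
    "('k, 'l) ring_scheme \<Rightarrow> ('k, 'a, 'm) module_scheme \<Rightarrow> ('k, 'b, 'n) module_scheme \<Rightarrow> ('a \<Rightarrow> 'b) set" where
  "linear_maps K M N = {f \<in> carrier M \<rightarrow> carrier N.
     (\<forall>u\<in>carrier M. \<forall>v\<in>carrier M. f (u \<oplus>\<^bsub>M\<^esub> v) = f u \<oplus>\<^bsub>N\<^esub> f v) \<and>
     (\<forall>c\<in>carrier K. \<forall>u\<in>carrier M. f (c \<odot>\<^bsub>M\<^esub> u) = c \<odot>\<^bsub>N\<^esub> f u)}"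

lemma linear_mapsD:
  assumes "f \<in> linear_maps K M N"
  shows "\<And>u. u \<in> carrier M \<Longrightarrow> f u \<in> carrier N"
    and "\<And>u v. \<lbrakk>u \<in> carrier M; v \<in> carrier M\<rbrakk> \<Longrightarrow> f (u \<oplus>\<^bsub>M\<^esub> v) = f u \<oplus>\<^bsub>N\<^esub> f v"
    and "\<And>c u. \<lbrakk>c \<in> carrier K; u \<in> carrier M\<rbrakk> \<Longrightarrow> f (c \<odot>\<^bsub>M\<^esub> u) = c \<odot>\<^bsub>N\<^esub> f u"
  using assms unfolding linear_maps_def by auto

text \<open>Intersecting with \<open>extensional\<close> fixes the values outside the carrier, so
  that equal operators are equal functions. The \<open>\<Omega>\<close>-operations are a parameter
  \<open>F\<close>, since the module does not determine them.\<close>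

definition endo_algebra ::
    "('k, 'l) ring_scheme \<Rightarrow> ('k, 'v, 'm) module_scheme \<Rightarrow>
     (nat \<Rightarrow> 'o \<Rightarrow> ('v \<Rightarrow> 'v) list \<Rightarrow> ('v \<Rightarrow> 'v)) \<Rightarrow> ('k, 'o, 'v \<Rightarrow> 'v) omega_alg" where
  "endo_algebra K M F =
     \<lparr>carrier = linear_maps K M M \<inter> extensional (carrier M),
      mult = compose (carrier M),
      one = (\<lambda>v\<in>carrier M. v),
      zero = (\<lambda>v\<in>carrier M. \<zero>\<^bsub>M\<^esub>),
      add = (\<lambda>f g. \<lambda>v\<in>carrier M. f v \<oplus>\<^bsub>M\<^esub> g v),
      smult = (\<lambda>c f. \<lambda>v\<in>carrier M. c \<odot>\<^bsub>M\<^esub> f v),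
      opn = F\<rparr>"

context module
begin

lemma endo_algebra_carrier:
  "f \<in> carrier (endo_algebra R M F) \<longleftrightarrow> f \<in> linear_maps R M M \<and> f \<in> extensional (carrier M)"
  by (simp add: endo_algebra_def)

lemma endo_algebra_ops:
  "\<zero>\<^bsub>endo_algebra R M F\<^esub> = (\<lambda>v\<in>carrier M. \<zero>\<^bsub>M\<^esub>)"
  "f \<oplus>\<^bsub>endo_algebra R M F\<^esub> g = (\<lambda>v\<in>carrier M. f v \<oplus>\<^bsub>M\<^esub> g v)"
  "c \<odot>\<^bsub>endo_algebra R M F\<^esub> f = (\<lambda>v\<in>carrier M. c \<odot>\<^bsub>M\<^esub> f v)"
  "f \<otimes>\<^bsub>endo_algebra R M F\<^esub> g = (\<lambda>v\<in>carrier M. f (g v))"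
  "opn (endo_algebra R M F) = F"
  by (simp_all add: endo_algebra_def compose_def)

lemma endo_algebra_closed:
  "\<zero>\<^bsub>endo_algebra R M F\<^esub> \<in> carrier (endo_algebra R M F)"
  "\<lbrakk>f \<in> carrier (endo_algebra R M F); g \<in> carrier (endo_algebra R M F)\<rbrakk> \<Longrightarrow>
    f \<oplus>\<^bsub>endo_algebra R M F\<^esub> g \<in> carrier (endo_algebra R M F)"
  "\<lbrakk>c \<in> carrier R; f \<in> carrier (endo_algebra R M F)\<rbrakk> \<Longrightarrow>
    c \<odot>\<^bsub>endo_algebra R M F\<^esub> f \<in> carrier (endo_algebra R M F)"
  "\<lbrakk>f \<in> carrier (endo_algebra R M F); g \<in> carrier (endo_algebra R M F)\<rbrakk> \<Longrightarrow>
    f \<otimes>\<^bsub>endo_algebra R M F\<^esub> g \<in> carrier (endo_algebra R M F)"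
  unfolding endo_algebra_carrier endo_algebra_ops
  by (auto simp: linear_maps_def smult_r_distr smult_assoc1[symmetric] R.m_comm M.a_ac Pi_iff)

lemma module_endo_algebra: "module R (endo_algebra R M F)"
proof -
  let ?E = "endo_algebra R M F"
  note E = endo_algebra_carrier endo_algebra_ops
  have ab: "abelian_group ?E"
  proof (rule abelian_groupI)
    fix f assume f: "f \<in> carrier ?E"
    then have "(\<ominus> \<one>) \<odot>\<^bsub>?E\<^esub> f \<in> carrier ?E"
      by (intro endo_algebra_closed) auto
    moreover have "(\<ominus> \<one>) \<odot>\<^bsub>?E\<^esub> f \<oplus>\<^bsub>?E\<^esub> f = \<zero>\<^bsub>?E\<^esub>"
      using f linear_mapsD(1)[of f R M M]
      by (intro extensionalityI[where A = "carrier M"]) (auto simp: E smult_l_minus M.l_neg)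
    ultimately show "\<exists>g\<in>carrier ?E. g \<oplus>\<^bsub>?E\<^esub> f = \<zero>\<^bsub>?E\<^esub>" by blast
  next
    fix f g h assume "f \<in> carrier ?E" "g \<in> carrier ?E" "h \<in> carrier ?E"
    then show "f \<oplus>\<^bsub>?E\<^esub> g \<oplus>\<^bsub>?E\<^esub> h = f \<oplus>\<^bsub>?E\<^esub> (g \<oplus>\<^bsub>?E\<^esub> h)"
      by (intro extensionalityI[where A = "carrier M"]) (auto simp: E dest!: linear_mapsD(1) intro!: M.a_assoc)
  next
    fix f g assume "f \<in> carrier ?E" "g \<in> carrier ?E"
    then show "f \<oplus>\<^bsub>?E\<^esub> g = g \<oplus>\<^bsub>?E\<^esub> f"
      by (intro extensionalityI[where A = "carrier M"]) (auto simp: E dest!: linear_mapsD(1) intro!: M.a_comm)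
  next
    fix f assume "f \<in> carrier ?E"
    then show "\<zero>\<^bsub>?E\<^esub> \<oplus>\<^bsub>?E\<^esub> f = f"
      by (intro extensionalityI[where A = "carrier M"]) (auto simp: E dest: linear_mapsD(1))
  qed (intro endo_algebra_closed; assumption)+
  show ?thesis
  proof (rule moduleI[OF R.is_cring ab])
    fix a b f g assume "a \<in> carrier R" "b \<in> carrier R" "f \<in> carrier ?E" "g \<in> carrier ?E"
    then show "(a \<oplus> b) \<odot>\<^bsub>?E\<^esub> f = a \<odot>\<^bsub>?E\<^esub> f \<oplus>\<^bsub>?E\<^esub> b \<odot>\<^bsub>?E\<^esub> f"
      and "a \<odot>\<^bsub>?E\<^esub> (f \<oplus>\<^bsub>?E\<^esub> g) = a \<odot>\<^bsub>?E\<^esub> f \<oplus>\<^bsub>?E\<^esub> a \<odot>\<^bsub>?E\<^esub> g"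
      and "(a \<otimes> b) \<odot>\<^bsub>?E\<^esub> f = a \<odot>\<^bsub>?E\<^esub> (b \<odot>\<^bsub>?E\<^esub> f)"
      by (intro extensionalityI[where A = "carrier M"];
          simp add: E linear_mapsD(1)[of _ R M M] smult_l_distr smult_r_distr smult_assoc1)+
  next
    fix f assume "f \<in> carrier ?E"
    then show "\<one> \<odot>\<^bsub>?E\<^esub> f = f"
      by (intro extensionalityI[where A = "carrier M"]) (auto simp: E dest: linear_mapsD(1))
  qed (intro endo_algebra_closed; assumption)
qed

text \<open>Associativity and distributivity on the left factor hold pointwise; additivity and
  homogeneity in the right factor use linearity of the left one. Beyond the field property, only
  conditions on \<open>F\<close> remain to be assumed.\<close>

lemma omega_algebra_endo_algebra:
  assumes K: "field R"
    and "\<And>n \<delta> fs. \<lbrakk>n \<ge> 1; \<delta> \<in> \<Omega> n; length fs = n; set fs \<subseteq> carrier (endo_algebra R M F)\<rbrakk> \<Longrightarrow>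
      F n \<delta> fs \<in> carrier (endo_algebra R M F)"
    and "\<And>n \<delta> fs i f g. \<lbrakk>n \<ge> 1; \<delta> \<in> \<Omega> n; length fs = n; set fs \<subseteq> carrier (endo_algebra R M F); i < n;
      f \<in> carrier (endo_algebra R M F); g \<in> carrier (endo_algebra R M F)\<rbrakk> \<Longrightarrow>
      F n \<delta> (fs[i := f \<oplus>\<^bsub>endo_algebra R M F\<^esub> g]) =
        F n \<delta> (fs[i := f]) \<oplus>\<^bsub>endo_algebra R M F\<^esub> F n \<delta> (fs[i := g])"
    and "\<And>n \<delta> fs i c f. \<lbrakk>n \<ge> 1; \<delta> \<in> \<Omega> n; length fs = n; set fs \<subseteq> carrier (endo_algebra R M F); i < n;
      c \<in> carrier R; f \<in> carrier (endo_algebra R M F)\<rbrakk> \<Longrightarrow>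
      F n \<delta> (fs[i := c \<odot>\<^bsub>endo_algebra R M F\<^esub> f]) =
        c \<odot>\<^bsub>endo_algebra R M F\<^esub> F n \<delta> (fs[i := f])"
  shows "omega_algebra R \<Omega> (endo_algebra R M F)" (is "omega_algebra R \<Omega> ?E")
proof (intro omega_algebra.intro omega_algebra_axioms.intro K module_endo_algebra)
  note E = endo_algebra_carrier endo_algebra_ops
  fix c f g h assume "f \<in> carrier ?E" "g \<in> carrier ?E"
  then have f: "f \<in> linear_maps R M M" and g: "g \<in> linear_maps R M M" by (auto simp: E)
  show "f \<otimes>\<^bsub>?E\<^esub> g \<in> carrier ?E" by (intro endo_algebra_closed) fact+
  show "(f \<otimes>\<^bsub>?E\<^esub> g) \<otimes>\<^bsub>?E\<^esub> h = f \<otimes>\<^bsub>?E\<^esub> (g \<otimes>\<^bsub>?E\<^esub> h)"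
    and "(f \<oplus>\<^bsub>?E\<^esub> g) \<otimes>\<^bsub>?E\<^esub> h = f \<otimes>\<^bsub>?E\<^esub> h \<oplus>\<^bsub>?E\<^esub> g \<otimes>\<^bsub>?E\<^esub> h"
    and "h \<otimes>\<^bsub>?E\<^esub> (f \<oplus>\<^bsub>?E\<^esub> g) = h \<otimes>\<^bsub>?E\<^esub> f \<oplus>\<^bsub>?E\<^esub> h \<otimes>\<^bsub>?E\<^esub> g"
    if "h \<in> carrier ?E"
    using that linear_mapsD[OF f] linear_mapsD[OF g] linear_mapsD[of h R M M]
    by (auto intro!: extensionalityI[where A = "carrier M"] simp: E)
  assume c: "c \<in> carrier R"
  show "(c \<odot>\<^bsub>?E\<^esub> f) \<otimes>\<^bsub>?E\<^esub> g = c \<odot>\<^bsub>?E\<^esub> (f \<otimes>\<^bsub>?E\<^esub> g)"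
    and "f \<otimes>\<^bsub>?E\<^esub> (c \<odot>\<^bsub>?E\<^esub> g) = c \<odot>\<^bsub>?E\<^esub> (f \<otimes>\<^bsub>?E\<^esub> g)"
    using c linear_mapsD[OF f] linear_mapsD[OF g]
    by (auto intro!: extensionalityI[where A = "carrier M"] simp: E)
qed (simp_all only: endo_algebra_ops(5) assms)

end

section \<open>Sequences and the unitization as modules\<close>

definition seq_module :: "('k, 'v, 'm) module_scheme \<Rightarrow> ('k, nat \<Rightarrow> 'v) module" where
  "seq_module M =
     \<lparr>carrier = {v. range v \<subseteq> carrier M}, mult = undefined, one = undefined,
      zero = (\<lambda>j. \<zero>\<^bsub>M\<^esub>),
      add = (\<lambda>u v j. u j \<oplus>\<^bsub>M\<^esub> v j),
      smult = (\<lambda>c v j. c \<odot>\<^bsub>M\<^esub> v j)\<rparr>"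

lemma seq_module_simps:
  "v \<in> carrier (seq_module M) \<longleftrightarrow> (\<forall>j. v j \<in> carrier M)"
  "(u \<oplus>\<^bsub>seq_module M\<^esub> v) = (\<lambda>j. u j \<oplus>\<^bsub>M\<^esub> v j)"
  "(c \<odot>\<^bsub>seq_module M\<^esub> v) = (\<lambda>j. c \<odot>\<^bsub>M\<^esub> v j)"
  "\<zero>\<^bsub>seq_module M\<^esub> = (\<lambda>j. \<zero>\<^bsub>M\<^esub>)"
  by (auto simp: seq_module_def)

lemma (in module) module_seq_module: "module R (seq_module M)"
proof -
  have ab: "abelian_group (seq_module M)"
  proof (rule abelian_groupI)
    fix v assume "v \<in> carrier (seq_module M)"
    then show "\<exists>u\<in>carrier (seq_module M). u \<oplus>\<^bsub>seq_module M\<^esub> v = \<zero>\<^bsub>seq_module M\<^esub>"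
      by (intro bexI[of _ "\<lambda>j. \<ominus>\<^bsub>M\<^esub> v j"]) (auto simp: seq_module_simps M.l_neg)
  qed (auto simp: seq_module_simps M.a_ac)
  show ?thesis
    by (rule moduleI[OF R.is_cring ab])
      (auto simp: seq_module_simps smult_r_distr smult_l_distr smult_assoc1)
qed

text \<open>This is the \<open>K\<close>-module underlying \<open>K \<oplus> A\<close>, with
  \<open>(1, 0)\<close> as the adjoined unit. Its multiplication enters only through
  \<open>left_mult\<close>.\<close>

definition unitization ::
    "('k, 'l) ring_scheme \<Rightarrow> ('k, 'a, 'm) module_scheme \<Rightarrow> ('k, 'k \<times> 'a) module" where
  "unitization K A =
     \<lparr>carrier = carrier K \<times> carrier A, mult = undefined, one = undefined,
      zero = (\<zero>\<^bsub>K\<^esub>, \<zero>\<^bsub>A\<^esub>),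
      add = (\<lambda>u v. (fst u \<oplus>\<^bsub>K\<^esub> fst v, snd u \<oplus>\<^bsub>A\<^esub> snd v)),
      smult = (\<lambda>c u. (c \<otimes>\<^bsub>K\<^esub> fst u, c \<odot>\<^bsub>A\<^esub> snd u))\<rparr>"

lemma (in module) module_unitization: "module R (unitization R M)"
proof -
  have ab: "abelian_group (unitization R M)"
  proof (rule abelian_groupI)
    fix v assume "v \<in> carrier (unitization R M)"
    then show "\<exists>u\<in>carrier (unitization R M). u \<oplus>\<^bsub>unitization R M\<^esub> v = \<zero>\<^bsub>unitization R M\<^esub>"
      by (intro bexI[of _ "(\<ominus> fst v, \<ominus>\<^bsub>M\<^esub> snd v)"])
        (auto simp: unitization_def M.l_neg R.l_neg)
  qed (auto simp: unitization_def M.a_ac R.a_ac)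
  show ?thesis
    by (rule moduleI[OF R.is_cring ab])
      (auto simp: unitization_def smult_r_distr smult_l_distr smult_assoc1 R.l_distr R.r_distr R.m_assoc)
qed

text \<open>This is the product \<open>(0, a) (k, b) = (0, k a + a b)\<close> in the unitization, as
  a map of the right factor.\<close>

definition left_mult ::
    "('k, 'l) ring_scheme \<Rightarrow> ('k, 'a, 'm) module_scheme \<Rightarrow> 'a \<Rightarrow> 'k \<times> 'a \<Rightarrow> 'k \<times> 'a" where
  "left_mult K A a u = (\<zero>\<^bsub>K\<^esub>, fst u \<odot>\<^bsub>A\<^esub> a \<oplus>\<^bsub>A\<^esub> a \<otimes>\<^bsub>A\<^esub> snd u)"

context omega_algebra
begin

lemma left_mult_linear:
  assumes "a \<in> carrier A"
  shows "left_mult K A a \<in> linear_maps K (unitization K A) (unitization K A)"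
  using assms
  by (auto simp: linear_maps_def left_mult_def unitization_def mult_closed smult_l_distr smult_r_distr
      smult_assoc1 mult_add_right mult_smult_right A.M.a_ac)

lemma left_mult_add:
  assumes "a \<in> carrier A" "b \<in> carrier A" "u \<in> carrier (unitization K A)"
  shows "left_mult K A (a \<oplus>\<^bsub>A\<^esub> b) u = left_mult K A a u \<oplus>\<^bsub>unitization K A\<^esub> left_mult K A b u"
  using assms
  by (auto simp: left_mult_def unitization_def mult_closed smult_r_distr mult_add_left A.M.a_ac)

lemma left_mult_smult:
  assumes "c \<in> carrier K" "a \<in> carrier A" "u \<in> carrier (unitization K A)"
  shows "left_mult K A (c \<odot>\<^bsub>A\<^esub> a) u = c \<odot>\<^bsub>unitization K A\<^esub> left_mult K A a u"
  using assms
  by (auto simp: left_mult_def unitization_def mult_closed smult_r_distr smult_assoc1[symmetric]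
      mult_smult_left K.m_comm)

lemma mult_zero_right: "a \<in> carrier A \<Longrightarrow> a \<otimes>\<^bsub>A\<^esub> \<zero>\<^bsub>A\<^esub> = \<zero>\<^bsub>A\<^esub>"
  using mult_smult_right[of \<zero> a "\<zero>\<^bsub>A\<^esub>"] by (simp add: mult_closed)

text \<open>The inner result has scalar part zero, so the outer map just multiplies its
  \<open>A\<close>-part by \<open>a\<close>, and associativity in \<open>A\<close> applies.\<close>

lemma left_mult_mult:
  assumes "a \<in> carrier A" "b \<in> carrier A" "u \<in> carrier (unitization K A)"
  shows "left_mult K A (a \<otimes>\<^bsub>A\<^esub> b) u = left_mult K A a (left_mult K A b u)"
  using assms
  by (auto simp: left_mult_def unitization_def mult_closed mult_add_right mult_smult_right mult_assoc)

text \<open>Acting on the adjoined unit recovers \<open>a\<close>, even where left multiplication on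
  \<open>A\<close> itself is not faithful. This is the source of the left inverse \<open>p\<close>
  below.\<close>

lemma left_mult_one: "a \<in> carrier A \<Longrightarrow> left_mult K A a (\<one>, \<zero>\<^bsub>A\<^esub>) = (\<zero>, a)"
  by (simp add: left_mult_def mult_zero_right)

section \<open>The two operators and the embedding of \<open>A\<close>\<close>

lemma sequence_in_two_generated:
  fixes a :: "nat \<Rightarrow> 'a"
  assumes a: "\<And>i. a i \<in> carrier A"
  obtains B :: "('k, 'o, (nat \<Rightarrow> 'k \<times> 'a) \<Rightarrow> (nat \<Rightarrow> 'k \<times> 'a)) omega_alg" and x y h
  where "omega_algebra K \<Omega> B" "x \<in> carrier B" "y \<in> carrier B" "x \<noteq> y"
    "h \<in> omega_hom K \<Omega> A B" "inj_on h (carrier A)"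
    "\<And>S i. \<lbrakk>omega_subalgebra K \<Omega> B S; x \<in> S; y \<in> S\<rbrakk> \<Longrightarrow> h (a i) \<in> S"
proof -
  define U where "U = unitization K A"
  define V where "V = seq_module U"
  define L where "L = left_mult K A"
  \<comment> \<open>The coefficients act on \<open>U\<close> as linear maps: the unit at index 0
    becomes \<open>id\<close>, and \<open>a i\<close> sits at index \<open>i + 1\<close> as a left
    multiplication.\<close>
  define c where "c j = (case j of 0 \<Rightarrow> id | Suc i \<Rightarrow> L (a i))" for j
  define x where "x = (\<lambda>v\<in>carrier V. \<lambda>j. v (Suc j))"
  define y where "y = (\<lambda>v\<in>carrier V. \<lambda>j. c j (v 0))"
  define h where "h b = (\<lambda>v\<in>carrier V. \<lambda>j. c j (L b (v 0)))" for b
  \<comment> \<open>For \<open>b\<close> in \<open>A\<close>, the entry at 0 of \<open>h b e\<close>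
    is \<open>c 0 (L b (1, 0)) = (0, b)\<close>, from which \<open>p\<close> reads off
    \<open>b\<close>.\<close>
  define e where "e = (\<lambda>j::nat. (\<one>, \<zero>\<^bsub>A\<^esub>))"
  define p where "p T = snd (T e 0)" for T :: "(nat \<Rightarrow> 'k \<times> 'a) \<Rightarrow> (nat \<Rightarrow> 'k \<times> 'a)"
  define F where "F n \<delta> Ts = h (opn A n \<delta> (map p Ts))" for n and \<delta> :: 'o and Ts
  define B where "B = endo_algebra K V F"
  interpret U: module K U unfolding U_def by (rule module_unitization)
  interpret V: module K V unfolding V_def by (rule U.module_seq_module)
  note Vs = seq_module_simps[where M = U, folded V_def]
  note Bs = V.endo_algebra_carrier[where F = F, folded B_def] V.endo_algebra_ops[where F = F, folded B_def]
  have L: "L b \<in> linear_maps K U U" if "b \<in> carrier A" for b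
    using left_mult_linear[OF that] by (simp add: U_def L_def)
  have c: "c j \<in> linear_maps K U U" for j
    using L[OF a] by (auto simp: c_def linear_maps_def split: nat.splits)
  note Ld = linear_mapsD[OF L] and cd = linear_mapsD[OF c]
  have x: "x \<in> carrier B" and y: "y \<in> carrier B"
    using cd by (auto simp: Bs x_def y_def linear_maps_def Vs)
  have h: "h b \<in> carrier B" if "b \<in> carrier A" for b
    using cd Ld[OF that] by (auto simp: Bs h_def linear_maps_def Vs)
  have h_lin: "h \<in> linear_maps K A B"
  proof -
    have "h (b \<oplus>\<^bsub>A\<^esub> b') = h b \<oplus>\<^bsub>B\<^esub> h b'" if "b \<in> carrier A" "b' \<in> carrier A" for b b'
      using that cd Ld left_mult_add[of b b', folded U_def L_def]
      by (intro extensionalityI[where A = "carrier V"]) (auto simp: Bs h_def Vs)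
    moreover have "h (k \<odot>\<^bsub>A\<^esub> b) = k \<odot>\<^bsub>B\<^esub> h b" if "k \<in> carrier K" "b \<in> carrier A" for k b
      using that cd Ld left_mult_smult[of k b, folded U_def L_def]
      by (intro extensionalityI[where A = "carrier V"]) (auto simp: Bs h_def Vs)
    ultimately show ?thesis using h unfolding linear_maps_def by blast
  qed
  \<comment> \<open>As \<open>c 0 = id\<close>, the entry at 0 of \<open>h b' v\<close> is
    \<open>L b' (v 0)\<close>; this is what \<open>h b\<close> acts on, so multiplicativity of
    \<open>L\<close> suffices.\<close>
  have h_mult: "h (b \<otimes>\<^bsub>A\<^esub> b') = h b \<otimes>\<^bsub>B\<^esub> h b'" if "b \<in> carrier A" "b' \<in> carrier A" for b b'
    using that cd Ld left_mult_mult[of b b', folded U_def L_def]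
    by (intro extensionalityI[where A = "carrier V"]) (auto simp: Bs h_def Vs c_def[of 0])
  have e: "e \<in> carrier V"
    by (simp add: e_def Vs U_def unitization_def)
  have ph: "p (h b) = b" if "b \<in> carrier A" for b
    using that e left_mult_one[OF that] by (simp add: p_def h_def c_def L_def e_def)
  have p_lin: "p \<in> linear_maps K B A"
  proof -
    have "p T \<in> carrier A" if "T \<in> carrier B" for T
    proof -
      have "T e \<in> carrier V" using that e by (auto simp: Bs dest: linear_mapsD(1))
      then show ?thesis by (auto simp: p_def Vs U_def unitization_def mem_Times_iff)
    qed
    moreover have "p (T \<oplus>\<^bsub>B\<^esub> T') = p T \<oplus>\<^bsub>A\<^esub> p T'" "p (k \<odot>\<^bsub>B\<^esub> T) = k \<odot>\<^bsub>A\<^esub> p T" for k T T'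
      using e by (simp_all add: p_def Bs(3,4) Vs(2,3)) (simp_all add: U_def unitization_def)
    ultimately show ?thesis unfolding linear_maps_def by blast
  qed
  note hd = linear_mapsD[OF h_lin] and pd = linear_mapsD[OF p_lin]
  \<comment> \<open>\<open>F\<close> is multilinear because it is \<open>opn A\<close> with the
    linear map \<open>p\<close> applied to the arguments and the linear map \<open>h\<close> to the
    value.\<close>
  have alg: "omega_algebra K \<Omega> B"
    unfolding B_def
  proof (rule V.omega_algebra_endo_algebra[OF K.field_axioms], fold B_def)
    fix n \<delta> fs
    assume n: "n \<ge> 1" "\<delta> \<in> \<Omega> n" "length fs = n" "set fs \<subseteq> carrier B"
    then have pfs: "length (map p fs) = n" "set (map p fs) \<subseteq> carrier A"
      using pd(1) by auto
    have opn_in: "opn A n \<delta> ((map p fs)[i := b]) \<in> carrier A" if "b \<in> carrier A" for i b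
      using n pfs that by (intro opn_closed set_update_subsetI) simp_all
    show "F n \<delta> fs \<in> carrier B"
      unfolding F_def using n pfs by (intro hd opn_closed)
    fix i f assume i: "i < n" and f: "f \<in> carrier B"
    show "F n \<delta> (fs[i := f \<oplus>\<^bsub>B\<^esub> g]) = F n \<delta> (fs[i := f]) \<oplus>\<^bsub>B\<^esub> F n \<delta> (fs[i := g])"
      if "g \<in> carrier B" for g
      using that f pd opn_in hd(2)
      by (simp add: F_def map_update opn_add[OF n(1,2) pfs i])
    show "F n \<delta> (fs[i := k \<odot>\<^bsub>B\<^esub> f]) = k \<odot>\<^bsub>B\<^esub> F n \<delta> (fs[i := f])"
      if "k \<in> carrier K" for k
      using that f pd opn_in hd(3)
      by (simp add: F_def map_update opn_smult[OF n(1,2) pfs i])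
  qed
  have xy: "x \<noteq> y"
  proof
    assume "x = y"
    \<comment> \<open>On this sequence the shift has entry \<open>v 1 = (1, 0)\<close> at 0, whereas
      \<open>y\<close> has \<open>v 0\<close>, which is zero.\<close>
    define v where "v j = (if j = 0 then \<zero>\<^bsub>U\<^esub> else (\<one>, \<zero>\<^bsub>A\<^esub>))" for j :: nat
    have "v \<in> carrier V"
      by (auto simp: Vs v_def U_def unitization_def)
    then have "(\<one>, \<zero>\<^bsub>A\<^esub>) = \<zero>\<^bsub>U\<^esub>"
      using fun_cong[OF fun_cong[OF \<open>x = y\<close>, of v], of 0] by (simp add: x_def y_def c_def v_def)
    then show False by (simp add: U_def unitization_def)
  qed
  have hom: "h \<in> omega_hom K \<Omega> A B"
  proof -
    have "h (opn A n \<delta> bs) = opn B n \<delta> (map h bs)" if "set bs \<subseteq> carrier A" for n \<delta> bs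
    proof -
      \<comment> \<open>Since \<open>p\<close> undoes \<open>h\<close>, the operation
        \<open>F\<close> on images under \<open>h\<close> is \<open>h\<close> of the original
        operation.\<close>
      have "map (p \<circ> h) bs = bs" using that ph by (intro map_idI) auto
      then show ?thesis by (simp add: Bs F_def)
    qed
    then show ?thesis
      using hd h_mult unfolding omega_hom_def hom_def by auto
  qed
  have inj: "inj_on h (carrier A)"
    using ph by (metis inj_on_inverseI)
  have gen: "h (a i) \<in> S" if S: "omega_subalgebra K \<Omega> B S" "x \<in> S" "y \<in> S" for S i
  proof -
    note Sd = omega_algebra.omega_subalgebraD[OF alg S(1)]
    \<comment> \<open>The witness is \<open>y\<close> followed by \<open>i\<close> shifts, that is,
      \<open>x^i y\<close>.\<close>
    have shift: "\<exists>T\<in>S. \<forall>v\<in>carrier V. T v = (\<lambda>j. c (j + i) (v 0))" for i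
    proof (induction i)
      case 0
      then show ?case using S(3) by (intro bexI[of _ y]) (auto simp: y_def)
    next
      case (Suc i)
      then obtain T where T: "T \<in> S" "\<forall>v\<in>carrier V. T v = (\<lambda>j. c (j + i) (v 0))" by blast
      then have "\<forall>v\<in>carrier V. (x \<otimes>\<^bsub>B\<^esub> T) v = (\<lambda>j. c (j + Suc i) (v 0))"
        using cd(1) by (auto simp: Bs x_def Vs)
      then show ?case using Sd(5)[OF S(2) T(1)] by blast
    qed
    obtain T where T: "T \<in> S" "\<forall>v\<in>carrier V. T v = (\<lambda>j. c (j + Suc i) (v 0))"
      using shift[of "Suc i"] by blast
    \<comment> \<open>The entry at 0 of \<open>T v\<close> is
      \<open>c (i + 1) (v 0) = L (a i) (v 0)\<close>, and the final \<open>y\<close> spreads it over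
      all entries with the coefficients \<open>c j\<close>, as in \<open>h (a i)\<close>.\<close>
    have "y \<otimes>\<^bsub>B\<^esub> T = h (a i)"
      using T(2) cd(1) by (intro extensionalityI[where A = "carrier V"]) (auto simp: Bs y_def h_def Vs c_def[of "Suc i"])
    then show ?thesis using Sd(5)[OF S(3) T(1)] by simp
  qed
  show thesis
    using that alg x y xy hom inj gen by blast
qed

text \<open>This reduces the inclusion of the image of \<open>h\<close> in \<open>S\<close> to a
  check on generators of \<open>A\<close>.\<close>

lemma omega_subalgebra_vimage:
  assumes B: "omega_algebra K \<Omega> B" and h: "h \<in> omega_hom K \<Omega> A B" and S: "omega_subalgebra K \<Omega> B S"
  shows "omega_subalgebra K \<Omega> A {b \<in> carrier A. h b \<in> S}"
proof (rule omega_subalgebraI)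
  note Sd = omega_algebra.omega_subalgebraD[OF B S]
  have modB: "module K B" using B by (rule omega_algebra.axioms)
  note hd = omega_homD[OF h]
  \<comment> \<open>Zero is written as the scalar zero times itself, so that preservation of scalar
    multiples applies.\<close>
  have "h \<zero>\<^bsub>A\<^esub> = \<zero>\<^bsub>B\<^esub>"
    using hd(4)[of \<zero> "\<zero>\<^bsub>A\<^esub>"] module.smult_l_null[OF modB hd(1), of "\<zero>\<^bsub>A\<^esub>"] by simp
  then show "\<zero>\<^bsub>A\<^esub> \<in> {b \<in> carrier A. h b \<in> S}" using Sd(2) by simp
  show "b \<oplus>\<^bsub>A\<^esub> b' \<in> {b \<in> carrier A. h b \<in> S}" "b \<otimes>\<^bsub>A\<^esub> b' \<in> {b \<in> carrier A. h b \<in> S}"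
    if "b \<in> {b \<in> carrier A. h b \<in> S}" "b' \<in> {b \<in> carrier A. h b \<in> S}" for b b'
    using that by (simp_all add: hd(2,3) Sd mult_closed)
  show "k \<odot>\<^bsub>A\<^esub> b \<in> {b \<in> carrier A. h b \<in> S}"
    if "k \<in> carrier K" "b \<in> {b \<in> carrier A. h b \<in> S}" for k b
    using that by (simp add: hd(4) Sd)
  show "opn A n \<delta> bs \<in> {b \<in> carrier A. h b \<in> S}"
    if "n \<ge> 1" "\<delta> \<in> \<Omega> n" "length bs = n" "set bs \<subseteq> {b \<in> carrier A. h b \<in> S}" for n \<delta> bs
  proof -
    have bs: "set bs \<subseteq> carrier A" "set (map h bs) \<subseteq> S" using that by auto
    have "h (opn A n \<delta> bs) = opn B n \<delta> (map h bs)"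
      using that(1-3) bs(1) by (rule hd(5))
    then show ?thesis
      using that(1-3) bs Sd(6)[of n \<delta> "map h bs"] opn_closed[of n \<delta> bs] by simp
  qed
qed blast

end

section \<open>Composition of the embedding into operators with the copy on expressions\<close>

theorem theorem6p1:
  fixes K :: "('k, 'l) ring_scheme"
    and \<Omega> :: "nat \<Rightarrow> 'o set"
    and A :: "('k, 'o, 'a, 'm) omega_alg_scheme"
  assumes "field K"
    and "omega_algebra K \<Omega> A"
    and "countably_generated K \<Omega> A"
  shows "\<exists>(H :: ('k, 'o, ('k, 'o) omega_expr set) omega_alg) h.
           omega_algebra K \<Omega> H \<and> two_generated K \<Omega> H \<and>
           h \<in> omega_hom K \<Omega> A H \<and> inj_on h (carrier A)"
proof -
  interpret omega_algebra K \<Omega> A by fact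
  obtain Y where Y: "countable Y" "Y \<subseteq> carrier A" "omega_span K \<Omega> A Y = carrier A"
    using assms(3) unfolding countably_generated_def omega_generated_by_def by blast
  \<comment> \<open>Inserting zero makes the set nonempty, so \<open>from_nat_into\<close>
    enumerates all of it even if \<open>Y\<close> is empty.\<close>
  define a where "a = from_nat_into (insert \<zero>\<^bsub>A\<^esub> Y)"
  have a: "range a = insert \<zero>\<^bsub>A\<^esub> Y"
    unfolding a_def using Y(1) by (intro range_from_nat_into) auto
  have "a i \<in> carrier A" for i
  proof -
    have "a i \<in> insert \<zero>\<^bsub>A\<^esub> Y" using a by blast
    then show ?thesis using Y(2) by auto
  qed
  then obtain B :: "('k, 'o, (nat \<Rightarrow> 'k \<times> 'a) \<Rightarrow> (nat \<Rightarrow> 'k \<times> 'a)) omega_alg" and x y h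
    where B: "omega_algebra K \<Omega> B" "x \<in> carrier B" "y \<in> carrier B" "x \<noteq> y"
      and h: "h \<in> omega_hom K \<Omega> A B" "inj_on h (carrier A)"
      and gen: "\<And>S i. \<lbrakk>omega_subalgebra K \<Omega> B S; x \<in> S; y \<in> S\<rbrakk> \<Longrightarrow> h (a i) \<in> S"
    using sequence_in_two_generated[of a] by metis
  obtain S and H :: "('k, 'o, ('k, 'o) omega_expr set) omega_alg" and \<phi>
    where S: "omega_subalgebra K \<Omega> B S" "x \<in> S" "y \<in> S"
      and H: "omega_algebra K \<Omega> H" "two_generated K \<Omega> H"
      and \<phi>: "\<phi> \<in> omega_hom K \<Omega> (B\<lparr>carrier := S\<rparr>) H" "inj_on \<phi> S"
    using omega_algebra.two_generated_expr_copy[OF B] .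
  \<comment> \<open>As \<open>\<phi>\<close> is a homomorphism on \<open>S\<close> only,
    \<open>h\<close> must land there: the preimage of \<open>S\<close> is a subalgebra containing
    \<open>Y\<close>, hence all of \<open>A\<close>.\<close>
  have "omega_subalgebra K \<Omega> A {b \<in> carrier A. h b \<in> S}"
    by (rule omega_subalgebra_vimage[OF B(1) h(1) S(1)])
  moreover have "h b \<in> S" if "b \<in> Y" for b
    using gen[OF S] a that by (metis insertI2 rangeE)
  then have "Y \<subseteq> {b \<in> carrier A. h b \<in> S}" using Y(2) by blast
  ultimately have hS: "h b \<in> S" if "b \<in> carrier A" for b
    using that Y(3) unfolding omega_span_def by blast
  note hd = omega_homD[OF h(1)] and \<phi>d = omega_homD[OF \<phi>(1), simplified]
  have "\<phi> \<circ> h \<in> omega_hom K \<Omega> A H"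
  proof (rule omega_homI)
    fix n \<delta> bs
    assume n: "n \<ge> 1" "\<delta> \<in> \<Omega> n" "length bs = n" "set bs \<subseteq> carrier A"
    then have "set (map h bs) \<subseteq> S" using hS by auto
    then have "\<phi> (opn B n \<delta> (map h bs)) = opn H n \<delta> (map \<phi> (map h bs))"
      using omega_homD(5)[OF \<phi>(1), of n \<delta> "map h bs"] n by simp
    then show "(\<phi> \<circ> h) (opn A n \<delta> bs) = opn H n \<delta> (map (\<phi> \<circ> h) bs)"
      using hd(5)[OF n] by simp
  qed (simp_all add: hd(2-4) \<phi>d(1-4) hS)
  moreover have "inj_on (\<phi> \<circ> h) (carrier A)"
    using h(2) \<phi>(2) hS by (intro comp_inj_on) (auto intro: inj_on_subset)
  ultimately show ?thesis using H by blast
qed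

end
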